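(* Let $C_x\subset\mathbb{R}^n$, $C_u\subset\mathbb{R}^m$, $C:=C_x\times C_u$, let $F:\mathbb{R}^n\times\mathbb{R}^m\rightrightarrows\mathbb{R}^n$ and $\mathcal{U}:C_x\rightrightarrows C_u$ be set-valued maps, and consider the constrained differential inclusion $\Sigma_{\mathcal U}:\ \dot x\in F(x,u),\ u\in\mathcal{U}(x),\ x\in C_x$. Assume: (A1) $C$ is closed; (A2) $F:C\rightrightarrows\mathbb{R}^n$ is upper semicontinuous and $F(x,u)$ is nonempty, compact and convex for all $(x,u)\in C$; (A3) $\mathcal{U}$ is lower semicontinuous with nonempty, closed and convex values; (A4) $F$ is convex in $u$; (A5) $\mathcal{U}$ is outer semicontinuous. Let $X_o\subset C_x$ and $X_u\subset\mathbb{R}^n$ with $X_o\cap X_u=\emptyset$, let $B:\mathbb{R}^n\to\mathbb{R}$ be a locally Lipschitz control barrier function with respect to $(X_o,X_u)$ for $\Sigma_{\mathcal U}$, and let $K:=\{x\in\mathbb{R}^n: B(x)\le0\}\cap C_x$. For $(x,u)\in C_x\times C_u$ let $$g(x,u):=\sup\{\langle\zeta,\eta\rangle:\zeta\in\partial_CB(x),\ \eta\in F(x,u)\},$$ $$D_0(x):=\{u\in\mathcal{U}(x):g(x,u)<0\},\qquad \bar D_0(x):=\{u\in\mathcal{U}(x):g(x,u)\le0\}.$$ Suppose: 1) $g$ is convex in $u$; 2) there exists a neighborhood of $\partial K$ such that $D_0(x)$ is nonempty for all $x\in C_x$ in that neighborhood. Let $U(K)$ be an open neighborhood of $K$ and $S_1:=\operatorname{cl}\big((U(K)\setminus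 K)\cap C_x\big)$ be such that for all $x\in S_1$, $D_0(x)$ is nonempty and $\inf_{u\in\mathcal{U}(x)}\sup_{\eta\in F(x,u),\,\zeta\in\partial_CB(x)}\langle\zeta,\eta\rangle\le0$. Suppose $\widetilde{\mathcal U}:C_x\rightrightarrows C_u$ satisfies: 3) $\widetilde{\mathcal U}$ is continuous with nonempty, closed and convex values; 4) $\widetilde{\mathcal U}(x)\subset\bar D_0(x)$ for each $x\in S_1$; 5) $\widetilde{\mathcal U}(x)\subset\mathcal{U}(x)$ for each $x\in C_x$. Let $\mathcal{L}:\mathbb{R}^n\times\mathbb{R}^m\to\mathbb{R}$ be proper, lower semicontinuous, convex in both arguments (jointly), and strictly convex in its second argument, and define $$\kappa^*(x):=\operatorname*{arg\,min}_{u\in\widetilde{\mathcal U}(x)}\mathcal{L}(x,u),\qquad x\in C_x.$$ If either $\mathcal{L}$ is sublevel bounded in $u$, or $\widetilde{\mathcal U}$ has bounded values, then $\kappa^*$ is continuous on $\operatorname{int}(C_x)$, and the resulting differential inclusion $\Sigma_{\kappa^*}:\ \dot x\in F(x,\kappa^*(x)),\ x\in C_x$, is safe with respect to $(X_o,X_u)$.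
   Context: Set-valued map notions, for $\Phi:A\rightrightarrows\mathbb{R}^p$ with $A\subset\mathbb{R}^q$. $\Phi$ is upper semicontinuous at $x\in A$ if for each $\varepsilon>0$ there is a neighborhood $U(x)$ of $x$ with $\Phi(y)\subset\Phi(x)+\varepsilon\mathbb{B}$ for all $y\in U(x)\cap A$ ($\mathbb{B}$ is the closed unit ball). $\Phi$ is lower semicontinuous at $x\in A$ if for every open set $V$ with $\Phi(x)\cap V\neq\emptyset$ there is a neighborhood $U(x)$ with $\Phi(z)\cap V\neq\emptyset$ for all $z\in U(x)\cap A$. $\Phi$ is outer semicontinuous at $x\in A$ if for all sequences $x_i\in A$, $x_i\to x$, and $y_i\in\Phi(x_i)$ with $y_i\to y\in\mathbb{R}^p$, we have $y\in\Phi(x)$. $\Phi$ is continuous at $x$ if it is both outer and lower semicontinuous at $x$. Each property without reference to a point means it holds at all points of $A$. "$F$ is convex in $u$" means: $C_u$ is convex and for each $x\in C_x$, $u_1,u_2\in C_u$, $\theta\in[0,1]$, $F(x,\theta u_1+(1-\theta)u_2)\subset\theta F(x,u_1)+(1-\theta)F(x,u_2)$ (Minkowski sum). $\partial_C B(x)$ is the Clarke generalized gradient of the locally Lipschitz function $B$ at $x$. $\partial K$, $\operatorname{int}(K)$, $\operatorname{cl}(K)$ are the boundary, interior and closure in $\mathbb{R}^n$. Control barrier function (CBF): a locally Lipschitz $B:\mathbb{R}^n\to\mathbb{R}$ such that $B(x)>0$ for all $x\in X_u$ and $B(x)\le 0$ for all $x\in X_o$, and such that there is an open neighborhood $U_1(\partial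 K)$ of $\partial K$ with $$\inf_{u\in\mathcal{U}(x)}\ \sup_{\eta\in F(x,u),\ \zeta\in\partial_C B(x)}\langle\zeta,\eta\rangle\le 0\qquad\forall x\in\big(U_1(\partial K)\setminus\operatorname{int}(K)\big)\cap C_x .$$ "$\mathcal{L}$ is sublevel bounded in $u$" means that for each $x$ and each finite $\alpha\in\mathbb{R}$ the set $\{u:\mathcal{L}(x,u)\le\alpha\}$ is bounded. A function is proper if it never takes the value $-\infty$ and is finite somewhere (automatic for real-valued $\mathcal L$). Solutions: a solution to $\dot x\in\widetilde F(x),\ x\in C_x$, is a function $x:\operatorname{dom}x\to\mathbb{R}^n$, with $\operatorname{dom}x\subset[0,\infty)$ an interval containing $0$, such that $x(0)\in\operatorname{cl}(C_x)$, $x$ is locally absolutely continuous, $x(t)\in C_x$ for all $t\in\operatorname{int}(\operatorname{dom}x)$, and $\dot x(t)\in\widetilde F(x(t))$ for almost all $t\in\operatorname{dom}x$. Safety: such a system is safe with respect to $(X_o,X_u)$ if every solution $x$ starting from a point $x(0)\in X_o$ satisfies $x(t)\in\mathbb{R}^n\setminus X_u$ for all $t\in\operatorname{dom}x$. *)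

theory Defs
  imports "HOL-Analysis.Analysis"
begin

section \<open>Set-valued maps\<close>

text \<open>A set-valued map defined on a set \<open>A\<close> is a total set-valued function; only its values on
  \<open>A\<close> matter below.\<close>

definition usc_setmap_at ::
    "'a::metric_space set \<Rightarrow> ('a \<Rightarrow> 'b::real_normed_vector set) \<Rightarrow> 'a \<Rightarrow> bool" where
  "usc_setmap_at A \<Phi> x \<longleftrightarrow>
     (\<forall>e>0. \<exists>N. open N \<and> x \<in> N \<and>
        (\<forall>y\<in>N \<inter> A. \<Phi> y \<subseteq> {a + e *\<^sub>R b | a b. a \<in> \<Phi> x \<and> b \<in> cball 0 1}))"

definition lsc_setmap_at ::
    "'a::metric_space set \<Rightarrow> ('a \<Rightarrow> 'b::real_normed_vector set) \<Rightarrow> 'a \<Rightarrow> bool" where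
  "lsc_setmap_at A \<Phi> x \<longleftrightarrow>
     (\<forall>V. open V \<and> \<Phi> x \<inter> V \<noteq> {} \<longrightarrow>
        (\<exists>N. open N \<and> x \<in> N \<and> (\<forall>z\<in>N \<inter> A. \<Phi> z \<inter> V \<noteq> {})))"

definition osc_setmap_at ::
    "'a::metric_space set \<Rightarrow> ('a \<Rightarrow> 'b::real_normed_vector set) \<Rightarrow> 'a \<Rightarrow> bool" where
  "osc_setmap_at A \<Phi> x \<longleftrightarrow>
     (\<forall>X Y y. (\<forall>i::nat. X i \<in> A \<and> Y i \<in> \<Phi> (X i)) \<and> X \<longlonglongrightarrow> x \<and> Y \<longlonglongrightarrow> y \<longrightarrow> y \<in> \<Phi> x)"

definition usc_setmap where
  "usc_setmap A \<Phi> \<longleftrightarrow> (\<forall>x\<in>A. usc_setmap_at A \<Phi> x)"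

definition lsc_setmap where
  "lsc_setmap A \<Phi> \<longleftrightarrow> (\<forall>x\<in>A. lsc_setmap_at A \<Phi> x)"

definition osc_setmap where
  "osc_setmap A \<Phi> \<longleftrightarrow> (\<forall>x\<in>A. osc_setmap_at A \<Phi> x)"

definition continuous_setmap where
  "continuous_setmap A \<Phi> \<longleftrightarrow> (\<forall>x\<in>A. osc_setmap_at A \<Phi> x \<and> lsc_setmap_at A \<Phi> x)"

definition setmap_convex_in_snd ::
    "'a set \<Rightarrow> 'b::real_vector set \<Rightarrow> ('a \<times> 'b \<Rightarrow> 'c::real_vector set) \<Rightarrow> bool" where
  "setmap_convex_in_snd Cx Cu F \<longleftrightarrow>
     convex Cu \<and>
     (\<forall>x\<in>Cx. \<forall>u1\<in>Cu. \<forall>u2\<in>Cu. \<forall>\<theta>\<in>{0..1}.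
        F (x, \<theta> *\<^sub>R u1 + (1 - \<theta>) *\<^sub>R u2)
          \<subseteq> {\<theta> *\<^sub>R a + (1 - \<theta>) *\<^sub>R b | a b. a \<in> F (x, u1) \<and> b \<in> F (x, u2)})"


section \<open>Real and extended-real functions\<close>

definition lower_semicontinuous :: "('a::topological_space \<Rightarrow> real) \<Rightarrow> bool" where
  "lower_semicontinuous f \<longleftrightarrow> (\<forall>z. \<forall>a<f z. \<forall>\<^sub>F w in nhds z. a < f w)"

definition strictly_convex_in_snd :: "('a \<times> 'b::real_vector \<Rightarrow> real) \<Rightarrow> bool" where
  "strictly_convex_in_snd L \<longleftrightarrow>
     (\<forall>x u1 u2 \<theta>. u1 \<noteq> u2 \<and> 0 < \<theta> \<and> \<theta> < 1 \<longrightarrow>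
        L (x, \<theta> *\<^sub>R u1 + (1 - \<theta>) *\<^sub>R u2) < \<theta> * L (x, u1) + (1 - \<theta>) * L (x, u2))"

definition sublevel_bounded_in_snd :: "('a \<times> 'b::metric_space \<Rightarrow> real) \<Rightarrow> bool" where
  "sublevel_bounded_in_snd L \<longleftrightarrow> (\<forall>x \<alpha>. bounded {u. L (x, u) \<le> \<alpha>})"

definition ereal_convex_in_snd ::
    "'a set \<Rightarrow> 'b::real_vector set \<Rightarrow> ('a \<times> 'b \<Rightarrow> ereal) \<Rightarrow> bool" where
  "ereal_convex_in_snd Cx Cu g \<longleftrightarrow>
     convex Cu \<and>
     (\<forall>x\<in>Cx. \<forall>u1\<in>Cu. \<forall>u2\<in>Cu. \<forall>\<theta>\<in>{0..1}.
        g (x, \<theta> *\<^sub>R u1 + (1 - \<theta>) *\<^sub>R u2)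
          \<le> ereal \<theta> * g (x, u1) + ereal (1 - \<theta>) * g (x, u2))"

definition locally_lipschitz :: "('a::metric_space \<Rightarrow> 'b::metric_space) \<Rightarrow> bool" where
  "locally_lipschitz f \<longleftrightarrow> (\<forall>x. \<exists>r>0. \<exists>M. M-lipschitz_on (cball x r) f)"

text \<open>Clarke's generalized directional derivative
  \<open>limsup ((B (y + t v) - B y) / t)\<close> as \<open>y \<rightarrow> x\<close> and \<open>t \<down> 0\<close>, and the generalized gradient as the
  set of vectors whose inner product it dominates.\<close>

definition clarke_dirderiv ::
    "('a::real_normed_vector \<Rightarrow> real) \<Rightarrow> 'a \<Rightarrow> 'a \<Rightarrow> ereal" where
  "clarke_dirderiv B x v =
     Limsup (nhds x \<times>\<^sub>F at_right 0) (\<lambda>(y, t). ereal ((B (y + t *\<^sub>R v) - B y) / t))"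

definition clarke_gradient :: "('a::real_inner \<Rightarrow> real) \<Rightarrow> 'a \<Rightarrow> 'a set" where
  "clarke_gradient B x = {\<zeta>. \<forall>v. ereal (\<zeta> \<bullet> v) \<le> clarke_dirderiv B x v}"


section \<open>Control barrier functions\<close>

definition barrier_set :: "('a \<Rightarrow> real) \<Rightarrow> 'a set \<Rightarrow> 'a set" where
  "barrier_set B Cx = {x. B x \<le> 0} \<inter> Cx"

text \<open>The supremum and the infimum over controls are taken in \<open>ereal\<close>, because the infimum may
  be \<open>-\<infinity>\<close>.\<close>

definition barrier_rate ::
    "('a::real_inner \<Rightarrow> real) \<Rightarrow> ('a \<times> 'b \<Rightarrow> 'a set) \<Rightarrow> 'a \<times> 'b \<Rightarrow> ereal" where
  "barrier_rate B F = (\<lambda>(x, u). SUP (\<zeta>, \<eta>)\<in>clarke_gradient B x \<times> F (x, u). ereal (\<zeta> \<bullet> \<eta>))"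

definition control_barrier_function ::
    "('a::real_inner \<times> 'b \<Rightarrow> 'a set) \<Rightarrow> ('a \<Rightarrow> 'b set) \<Rightarrow> 'a set \<Rightarrow> 'a set \<Rightarrow> 'a set
      \<Rightarrow> ('a \<Rightarrow> real) \<Rightarrow> bool" where
  "control_barrier_function F \<U> Cx Xo Xu B \<longleftrightarrow>
     locally_lipschitz B \<and>
     (\<forall>x\<in>Xu. 0 < B x) \<and> (\<forall>x\<in>Xo. B x \<le> 0) \<and>
     (\<exists>N. open N \<and> frontier (barrier_set B Cx) \<subseteq> N \<and>
        (\<forall>x\<in>(N - interior (barrier_set B Cx)) \<inter> Cx.
           (INF u\<in>\<U> x. barrier_rate B F (x, u)) \<le> 0))"

definition strict_decrease_controls ::
    "('a::real_inner \<Rightarrow> real) \<Rightarrow> ('a \<times> 'b \<Rightarrow> 'a set) \<Rightarrow> ('a \<Rightarrow> 'b set) \<Rightarrow> 'a \<Rightarrow> 'b set" where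
  "strict_decrease_controls B F \<U> x = {u \<in> \<U> x. barrier_rate B F (x, u) < 0}"

definition decrease_controls ::
    "('a::real_inner \<Rightarrow> real) \<Rightarrow> ('a \<times> 'b \<Rightarrow> 'a set) \<Rightarrow> ('a \<Rightarrow> 'b set) \<Rightarrow> 'a \<Rightarrow> 'b set" where
  "decrease_controls B F \<U> x = {u \<in> \<U> x. barrier_rate B F (x, u) \<le> 0}"

definition min_selection ::
    "('a \<times> 'b \<Rightarrow> real) \<Rightarrow> ('a \<Rightarrow> 'b set) \<Rightarrow> 'a \<Rightarrow> 'b" where
  "min_selection L \<U> x = arg_min_on (\<lambda>u. L (x, u)) (\<U> x)"


section \<open>Constrained differential inclusions and safety\<close>

definition absolutely_continuous_on_interval ::
    "real \<Rightarrow> real \<Rightarrow> (real \<Rightarrow> 'a::real_normed_vector) \<Rightarrow> bool" where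
  "absolutely_continuous_on_interval a b f \<longleftrightarrow>
     (\<forall>\<epsilon>>0. \<exists>\<delta>>0. \<forall>(n::nat) s t.
        (\<forall>i<n. a \<le> s i \<and> s i \<le> t i \<and> t i \<le> b) \<and>
        disjoint_family_on (\<lambda>i. {s i<..<t i}) {..<n} \<and>
        (\<Sum>i<n. t i - s i) < \<delta> \<longrightarrow>
        (\<Sum>i<n. norm (f (t i) - f (s i))) < \<epsilon>)"

definition locally_absolutely_continuous_on ::
    "real set \<Rightarrow> (real \<Rightarrow> 'a::real_normed_vector) \<Rightarrow> bool" where
  "locally_absolutely_continuous_on D f \<longleftrightarrow>
     (\<forall>a b. a \<le> b \<and> {a..b} \<subseteq> D \<longrightarrow> absolutely_continuous_on_interval a b f)"

text \<open>\<open>D\<close> is the domain of the solution; values of \<open>x\<close> outside \<open>D\<close> are irrelevant.\<close>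

definition inclusion_solution ::
    "('a::real_normed_vector \<Rightarrow> 'a set) \<Rightarrow> 'a set \<Rightarrow> real set \<Rightarrow> (real \<Rightarrow> 'a) \<Rightarrow> bool" where
  "inclusion_solution G Cx D x \<longleftrightarrow>
     is_interval D \<and> 0 \<in> D \<and> D \<subseteq> {0..} \<and>
     x 0 \<in> closure Cx \<and>
     locally_absolutely_continuous_on D x \<and>
     (\<forall>t\<in>interior D. x t \<in> Cx) \<and>
     (AE t in lebesgue. t \<in> D \<longrightarrow>
        (\<exists>v\<in>G (x t). (x has_vector_derivative v) (at t within D)))"

definition safe_inclusion ::
    "('a::real_normed_vector \<Rightarrow> 'a set) \<Rightarrow> 'a set \<Rightarrow> 'a set \<Rightarrow> 'a set \<Rightarrow> bool" where
  "safe_inclusion G Cx Xo Xu \<longleftrightarrow>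
     (\<forall>D x. inclusion_solution G Cx D x \<and> x 0 \<in> Xo \<longrightarrow> (\<forall>t\<in>D. x t \<in> - Xu))"

end

theory Submission
  imports Defs
begin

text \<open>
  The feedback \<open>\<kappa>\<close> selects from \<open>\<U>t x\<close> the unique minimizer of a strictly convex cost. A real-valued
  convex cost on a Euclidean space is continuous, so a minimizer exists once some sublevel set
  meets \<open>\<U>t x\<close> in a bounded set, and strict convexity makes it unique.

  Continuity of \<open>\<kappa>\<close> is Berge's maximum theorem without a compactness assumption; convexity replaces
  it (\<open>continuous_on_unique_minimizer\<close>). If \<open>\<kappa> y\<close> stayed at distance at least \<open>e\<close> from \<open>\<kappa> x\<close> for
  points \<open>y\<close> arbitrarily close to \<open>x\<close>, lower semicontinuity would give controls \<open>v \<in> \<U>t y\<close> close to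
  \<open>\<kappa> x\<close>, and the segment from \<open>v\<close> to \<open>\<kappa> y\<close> would cross the sphere of radius \<open>e\<close> about \<open>\<kappa> x\<close> at a
  control in \<open>\<U>t y\<close> that costs no more than \<open>v\<close>. The sphere is compact, so these crossing points
  accumulate, by outer semicontinuity at a second minimizer over \<open>\<U>t x\<close>.

  For safety it suffices that \<open>B\<close> does not increase along a solution in the part of \<open>UK\<close> outside
  \<open>K = {B \<le> 0} \<inter> Cx\<close>. A solution that reached \<open>Xu\<close>, where \<open>B > 0\<close>, would have a last time in \<open>K\<close>,
  and right after that time it would run through this region (\<open>barrier_invariance\<close>). There the
  selected control satisfies \<open>\<zeta> \<bullet> \<eta> \<le> 0\<close> for all generalized gradients \<open>\<zeta>\<close> and all velocities \<open>\<eta>\<close>.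

  Two facts turn these inner products into monotonicity of \<open>B\<close> along the solution. Clarke's
  directional derivative is sublinear in the direction, hence the support function of the
  generalized gradient, so it is nonpositive at every admissible velocity
  (\<open>clarke_dirderiv_nonpos\<close>); being a limsup over nearby base points, it bounds the difference
  quotients of \<open>B\<close> along the solution on both sides of a time of differentiability
  (\<open>clarke_nonpos_imp_slope\<close>). And an absolutely continuous function whose slopes are
  asymptotically nonpositive off a null set is nonincreasing (\<open>absolutely_continuous_nonincreasing\<close>).
\<close>

section \<open>Monotonicity of absolutely continuous functions\<close>

lemma absolutely_continuousE:
  assumes "absolutely_continuous_on_interval a b f" and "e > 0"
  obtains d where "d > 0" and "\<And>(n::nat) s t. (\<And>i. i < n \<Longrightarrow> a \<le> s i \<and> s i \<le> t i \<and> t i \<le> b) \<Longrightarrow>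
        disjoint_family_on (\<lambda>i. {s i<..<t i}) {..<n} \<Longrightarrow> (\<Sum>i<n. t i - s i) < d \<Longrightarrow>
        (\<Sum>i<n. norm (f (t i) - f (s i))) < e"
proof -
  have "\<exists>d>0. \<forall>(n::nat) s t. (\<forall>i<n. a \<le> s i \<and> s i \<le> t i \<and> t i \<le> b) \<and>
        disjoint_family_on (\<lambda>i. {s i<..<t i}) {..<n} \<and> (\<Sum>i<n. t i - s i) < d \<longrightarrow>
        (\<Sum>i<n. norm (f (t i) - f (s i))) < e"
    using assms unfolding absolutely_continuous_on_interval_def by (elim allE impE)
  then obtain d where "d > 0" and d: "\<forall>(n::nat) s t. (\<forall>i<n. a \<le> s i \<and> s i \<le> t i \<and> t i \<le> b) \<and>
        disjoint_family_on (\<lambda>i. {s i<..<t i}) {..<n} \<and> (\<Sum>i<n. t i - s i) < d \<longrightarrow>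
        (\<Sum>i<n. norm (f (t i) - f (s i))) < e" by (elim exE conjE)
  show ?thesis
    by (rule that[OF \<open>d > 0\<close>], rule d[rule_format]) simp
qed

lemma absolutely_continuous_imp_continuous_on:
  assumes "absolutely_continuous_on_interval a b f"
  shows "continuous_on {a..b} f"
proof -
  have "\<exists>d>0. \<forall>y\<in>{a..b}. dist y x < d \<longrightarrow> dist (f y) (f x) < e" if x: "x \<in> {a..b}" and e: "e > 0" for x e
  proof -
    obtain d where d: "d > 0" and D: "\<And>(n::nat) s t. (\<And>i. i < n \<Longrightarrow> a \<le> s i \<and> s i \<le> t i \<and> t i \<le> b) \<Longrightarrow>
        disjoint_family_on (\<lambda>i. {s i<..<t i}) {..<n} \<Longrightarrow> (\<Sum>i<n. t i - s i) < d \<Longrightarrow>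
        (\<Sum>i<n. norm (f (t i) - f (s i))) < e"
      using absolutely_continuousE[OF assms e] by blast
    have "dist (f y) (f x) < e" if y: "y \<in> {a..b}" "dist y x < d" for y
      using D[of 1 "\<lambda>_. min x y" "\<lambda>_. max x y"] x y
      by (cases "x \<le> y") (auto simp: disjoint_family_on_def dist_norm norm_minus_commute)
    with d show ?thesis by blast
  qed
  then show ?thesis unfolding continuous_on_iff by blast
qed

lemma absolutely_continuous_lipschitz_compose:
  assumes f: "absolutely_continuous_on_interval a b f"
    and "f ` {a..b} \<subseteq> S" and g: "M-lipschitz_on S g"
  shows "absolutely_continuous_on_interval a b (\<lambda>t. g (f t))"
  unfolding absolutely_continuous_on_interval_def
proof (intro allI impI)
  fix e :: real assume e: "e > 0"
  have M: "M \<ge> 0" using g by (rule lipschitz_on_nonneg)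
  then have "e / (M + 1) > 0" using e by simp
  then obtain d where d: "d > 0" and D: "\<And>(n::nat) s t. (\<And>i. i < n \<Longrightarrow> a \<le> s i \<and> s i \<le> t i \<and> t i \<le> b) \<Longrightarrow>
        disjoint_family_on (\<lambda>i. {s i<..<t i}) {..<n} \<Longrightarrow> (\<Sum>i<n. t i - s i) < d \<Longrightarrow>
        (\<Sum>i<n. norm (f (t i) - f (s i))) < e / (M + 1)"
    using absolutely_continuousE[OF f \<open>e / (M + 1) > 0\<close>] by blast
  have "(\<Sum>i<n. norm (g (f (t i)) - g (f (s i)))) < e"
    if st: "(\<forall>i<n. a \<le> s i \<and> s i \<le> t i \<and> t i \<le> b) \<and>
        disjoint_family_on (\<lambda>i. {s i<..<t i}) {..<n} \<and> (\<Sum>i<n. t i - s i) < d"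
    for n :: nat and s t
  proof -
    have "norm (g (f (t i)) - g (f (s i))) \<le> (M + 1) * norm (f (t i) - f (s i))" if "i < n" for i
    proof -
      have "t i \<in> {a..b}" "s i \<in> {a..b}" using st that by force+
      then have "f (t i) \<in> S" "f (s i) \<in> S" using assms(2) by auto
      then have "norm (g (f (t i)) - g (f (s i))) \<le> M * norm (f (t i) - f (s i))"
        using g by (auto simp: lipschitz_on_def dist_norm)
      also have "\<dots> \<le> (M + 1) * norm (f (t i) - f (s i))" by (intro mult_right_mono) auto
      finally show ?thesis .
    qed
    then have "(\<Sum>i<n. norm (g (f (t i)) - g (f (s i)))) \<le> (\<Sum>i<n. (M + 1) * norm (f (t i) - f (s i)))"
      by (intro sum_mono) auto
    also have "\<dots> = (M + 1) * (\<Sum>i<n. norm (f (t i) - f (s i)))" by (simp add: sum_distrib_left)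
    also have "\<dots> < (M + 1) * (e / (M + 1))" using D st M by (intro mult_strict_left_mono) auto
    also have "\<dots> = e" using M by simp
    finally show ?thesis .
  qed
  with d show "\<exists>\<delta>>0. \<forall>(n::nat) s t. (\<forall>i<n. a \<le> s i \<and> s i \<le> t i \<and> t i \<le> b) \<and>
        disjoint_family_on (\<lambda>i. {s i<..<t i}) {..<n} \<and> (\<Sum>i<n. t i - s i) < \<delta> \<longrightarrow>
        (\<Sum>i<n. norm (g (f (t i)) - g (f (s i)))) < e" by blast
qed

text \<open>A gauge argument. Take a tagged division that is fine enough for every cell with a regular tag
  to contribute at most \<open>e\<close> times its length to the increment of \<open>f\<close>, while the cells with tags in
  \<open>N\<close> lie in an open set of measure so small that, by absolute continuity, they contribute less
  than \<open>e\<close> in total. The slope condition compares points on the two sides of the tag, because a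
  tag may lie inside its cell.\<close>
lemma absolutely_continuous_nonincreasing:
  fixes f :: "real \<Rightarrow> real"
  assumes ab: "a \<le> b" and f: "absolutely_continuous_on_interval a b f" and N: "negligible N"
    and slope: "\<And>t e. t \<in> {a..b} - N \<Longrightarrow> e > 0 \<Longrightarrow>
      \<exists>d>0. \<forall>u\<in>{a..b}. \<forall>v\<in>{a..b}. u \<le> t \<and> t \<le> v \<and> t - u < d \<and> v - t < d \<longrightarrow> f v - f u \<le> e * (v - u)"
  shows "f b \<le> f a"
proof -
  have main: "f b - f a \<le> e * (b - a + 1)" if e: "e > 0" for e
  proof -
    obtain d where d: "d > 0" and D: "\<And>(n::nat) s t. (\<And>i. i < n \<Longrightarrow> a \<le> s i \<and> s i \<le> t i \<and> t i \<le> b) \<Longrightarrow>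
        disjoint_family_on (\<lambda>i. {s i<..<t i}) {..<n} \<Longrightarrow> (\<Sum>i<n. t i - s i) < d \<Longrightarrow>
        (\<Sum>i<n. norm (f (t i) - f (s i))) < e"
      using absolutely_continuousE[OF f e] by blast
    have "N \<in> sets lebesgue" using N by (simp add: negligible_imp_sets)
    then obtain T where T: "open T" "N \<subseteq> T" "T - N \<in> lmeasurable" "emeasure lebesgue (T - N) < ennreal d"
      using sets_lebesgue_outer_open d by metis
    have "T = N \<union> (T - N)" using T by blast
    then have T_meas: "T \<in> lmeasurable"
      using T(3) negligible_imp_measurable[OF N] fmeasurable.Un by metis
    have "measure lebesgue T = measure lebesgue (T - N)"
      using T_meas N by (simp add: measure_Diff_null_set negligible_iff_null_sets)
    also have "\<dots> < d"
      using T(3,4) d by (metis emeasure_eq_measure2 ennreal_less_iff measure_nonneg)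
    finally have T_small: "measure lebesgue T < d" .
    have "\<exists>r>0. t \<in> {a..b} - N \<longrightarrow> (\<forall>u\<in>{a..b}. \<forall>v\<in>{a..b}. u \<le> t \<and> t \<le> v \<and> t - u < r \<and> v - t < r
        \<longrightarrow> f v - f u \<le> e * (v - u))" for t
      using slope[OF _ e, of t] zero_less_one by blast
    then obtain r where r: "\<And>t. r t > 0" and R: "\<And>t u v. t \<in> {a..b} - N \<Longrightarrow> u\<in>{a..b} \<Longrightarrow> v\<in>{a..b} \<Longrightarrow>
        u \<le> t \<Longrightarrow> t \<le> v \<Longrightarrow> t - u < r t \<Longrightarrow> v - t < r t \<Longrightarrow> f v - f u \<le> e * (v - u)"
      by metis
    (* A cell tagged in N must stay inside T, any other cell within the slope radius of its tag. *)
    have "gauge (\<lambda>t. if t \<in> N then T else ball t (r t))"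
      using T r by (auto simp: gauge_def)
    then obtain p where p: "p tagged_division_of {a..b}"
      and fine: "(\<lambda>t. if t \<in> N then T else ball t (r t)) fine p"
      using fine_division_exists_real by blast
    have fin: "finite p" using p by auto
    have cell: "snd q = {Inf (snd q)..Sup (snd q)} \<and> Inf (snd q) \<le> fst q \<and> fst q \<le> Sup (snd q)
        \<and> a \<le> Inf (snd q) \<and> Sup (snd q) \<le> b" if "q \<in> p" for q
    proof -
      obtain t K where q: "q = (t, K)" by force
      have "t \<in> K" "K \<subseteq> {a..b}" "\<exists>u v. K = cbox u v"
        using tagged_division_ofD(2-4)[OF p] that q by blast+
      then obtain u v where "K = {u..v}" by auto
      then show ?thesis using \<open>t \<in> K\<close> \<open>K \<subseteq> {a..b}\<close> q by auto
    qed
    define P where "P = {q \<in> p. fst q \<in> N}"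
    have "finite P" "P \<subseteq> p" using fin by (auto simp: P_def)
    let ?df = "\<lambda>q::real \<times> real set. f (Sup (snd q)) - f (Inf (snd q))"
    let ?dt = "\<lambda>q::real \<times> real set. Sup (snd q) - Inf (snd q)"
    have regular: "?df q \<le> e * ?dt q" if "q \<in> p - P" for q
    proof -
      have *: "snd q \<subseteq> ball (fst q) (r (fst q))"
        using fineD[OF fine, of "fst q" "snd q"] that by (simp add: P_def)
      have "Inf (snd q) \<in> snd q" "Sup (snd q) \<in> snd q"
        using cell[of q] that by (metis DiffD1 atLeastAtMost_iff order.trans order_refl)+
      then have "Inf (snd q) \<in> ball (fst q) (r (fst q))" "Sup (snd q) \<in> ball (fst q) (r (fst q))"
        using * by blast+
      then show ?thesis
        using cell[of q] that by (intro R[of "fst q"]) (auto simp: P_def dist_real_def)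
    qed
    (* Absolute continuity speaks of finite sequences of intervals, so the cells are enumerated. *)
    obtain h where h: "bij_betw h {..<card P} P"
      using ex_bij_betw_nat_finite[OF \<open>finite P\<close>] by (auto simp: atLeast0LessThan)
    let ?s = "\<lambda>i. Inf (snd (h i))" and ?t = "\<lambda>i. Sup (snd (h i))"
    have hp: "h i \<in> P" "h i \<in> p" if "i < card P" for i
      using h that \<open>P \<subseteq> p\<close> by (auto dest!: bij_betw_imp_surj_on)
    have intr: "interior (snd (h i)) = {?s i<..<?t i}" if "i < card P" for i
      using cell[OF hp(2)[OF that]] by (metis interior_atLeastAtMost_real)
    have disj: "disjoint_family_on (\<lambda>i. {?s i<..<?t i}) {..<card P}"
      unfolding disjoint_family_on_def
    proof (intro ballI impI)
      fix i j assume ij: "i \<in> {..<card P}" "j \<in> {..<card P}" "i \<noteq> j"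
      then have "h i \<noteq> h j" using h by (meson bij_betw_def inj_onD)
      then have "interior (snd (h i)) \<inter> interior (snd (h j)) = {}"
        using tagged_division_ofD(5)[OF p, of "fst (h i)" "snd (h i)" "fst (h j)" "snd (h j)"] hp ij
        by auto
      then show "{?s i<..<?t i} \<inter> {?s j<..<?t j} = {}" using intr ij by simp
    qed
    have "(\<Sum>i<card P. ?t i - ?s i) = (\<Sum>i<card P. measure lebesgue {?s i<..<?t i})"
    proof (rule sum.cong[OF refl])
      fix i assume "i \<in> {..<card P}"
      then have "?s i \<le> ?t i" using cell[OF hp(2), of i] by force
      then show "?t i - ?s i = measure lebesgue {?s i<..<?t i}" by simp
    qed
    also have "\<dots> = measure lebesgue (\<Union>i<card P. {?s i<..<?t i})"
    proof (rule measure_finite_Union[symmetric])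
      show "emeasure lebesgue {?s i<..<?t i} \<noteq> \<infinity>" for i
        using emeasure_lborel_box_finite[of "?s i" "?t i"] by simp
    qed (use disj in auto)
    also have "\<dots> \<le> measure lebesgue T"
    proof (rule measure_mono_fmeasurable)
      show "(\<Union>i<card P. {?s i<..<?t i}) \<subseteq> T"
      proof (rule UN_least)
        fix i assume "i \<in> {..<card P}"
        then have "i < card P" by simp
        have "snd (h i) \<subseteq> T"
          using fineD[OF fine, of "fst (h i)" "snd (h i)"] hp[OF \<open>i < card P\<close>] by (simp add: P_def)
        then show "{?s i<..<?t i} \<subseteq> T"
          using intr[OF \<open>i < card P\<close>] interior_subset by blast
      qed
    qed (use T_meas in auto)
    finally have short: "(\<Sum>i<card P. ?t i - ?s i) < d" using T_small by linarith
    have "(\<Sum>q\<in>P. ?df q) = (\<Sum>i<card P. f (?t i) - f (?s i))"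
      using sum.reindex_bij_betw[OF h, of ?df] by simp
    also have "\<dots> \<le> (\<Sum>i<card P. norm (f (?t i) - f (?s i)))" by (intro sum_mono) auto
    also have "\<dots> < e"
    proof (rule D[OF _ disj short])
      show "a \<le> ?s i \<and> ?s i \<le> ?t i \<and> ?t i \<le> b" if "i < card P" for i
        using cell[OF hp(2)[OF that]] by linarith
    qed
    finally have exceptional: "(\<Sum>q\<in>P. ?df q) < e" .
    have "f b - f a = (\<Sum>q\<in>p. ?df q)"
      using additive_tagged_division_1[OF ab p, of f] by (simp add: case_prod_unfold)
    also have "\<dots> = (\<Sum>q\<in>p - P. ?df q) + (\<Sum>q\<in>P. ?df q)"
      using sum.subset_diff[OF \<open>P \<subseteq> p\<close> fin] by blast
    also have "\<dots> \<le> (\<Sum>q\<in>p - P. e * ?dt q) + e"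
      using exceptional by (intro add_mono sum_mono regular) auto
    also have "(\<Sum>q\<in>p - P. e * ?dt q) \<le> (\<Sum>q\<in>p. e * ?dt q)"
      using fin e cell by (intro sum_mono2) (fastforce intro!: mult_nonneg_nonneg)+
    also have "(\<Sum>q\<in>p. e * ?dt q) = e * (b - a)"
      using additive_tagged_division_1[OF ab p, of "\<lambda>t. t"]
      by (simp add: case_prod_unfold sum_distrib_left[symmetric])
    finally show ?thesis by (simp add: algebra_simps)
  qed
  show ?thesis
  proof (rule field_le_epsilon)
    fix e :: real assume "e > 0"
    then show "f b \<le> f a + e" using main[of "e / (b - a + 1)"] ab by simp
  qed
qed


section \<open>Clarke's directional derivative as a support function\<close>

lemma eventually_nhds_times_at_right_0:
  fixes x :: "'a::metric_space"
  shows "(\<forall>\<^sub>F z in nhds x \<times>\<^sub>F at_right (0::real). P z) \<longleftrightarrow>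
    (\<exists>d>0. \<forall>y t. dist y x < d \<and> 0 < t \<and> t < d \<longrightarrow> P (y, t))"
proof
  assume "\<forall>\<^sub>F z in nhds x \<times>\<^sub>F at_right (0::real). P z"
  then obtain P1 P2 where P: "eventually P1 (nhds x)" "eventually P2 (at_right (0::real))"
    "\<And>y t. P1 y \<Longrightarrow> P2 t \<Longrightarrow> P (y, t)"
    unfolding eventually_prod_filter by blast
  obtain d1 where d1: "d1 > 0" "\<And>y. dist y x < d1 \<Longrightarrow> P1 y"
    using P(1) unfolding eventually_nhds_metric by blast
  obtain d2 where d2: "d2 > 0" "\<And>t. 0 < t \<Longrightarrow> t < d2 \<Longrightarrow> P2 t"
    using P(2) unfolding eventually_at_right_field by blast
  show "\<exists>d>0. \<forall>y t. dist y x < d \<and> 0 < t \<and> t < d \<longrightarrow> P (y, t)"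
    using d1 d2 P(3) by (intro exI[of _ "min d1 d2"]) simp
next
  assume "\<exists>d>0. \<forall>y t. dist y x < d \<and> 0 < t \<and> t < d \<longrightarrow> P (y, t)"
  then obtain d where d: "d > 0" "\<And>y t. dist y x < d \<Longrightarrow> 0 < t \<Longrightarrow> t < d \<Longrightarrow> P (y, t)" by blast
  show "\<forall>\<^sub>F z in nhds x \<times>\<^sub>F at_right (0::real). P z"
    unfolding eventually_prod_filter
  proof (intro exI conjI)
    show "\<forall>\<^sub>F y in nhds x. dist y x < d" using d(1) unfolding eventually_nhds_metric by blast
    show "\<forall>\<^sub>F t in at_right (0::real). 0 < t \<and> t < d"
      using d(1) unfolding eventually_at_right_field by blast
  qed (use d(2) in blast)
qed

text \<open>Upper bounds on the limsup in terms of plain real inequalities: sublinearity of the directional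
  derivative can be proved from them without arithmetic in \<^typ>\<open>ereal\<close>.\<close>
lemma clarke_dirderiv_le_iff:
  "clarke_dirderiv B x v \<le> ereal s \<longleftrightarrow>
    (\<forall>c>s. \<exists>d>0. \<forall>y t. dist y x < d \<and> 0 < t \<and> t < d \<longrightarrow> B (y + t *\<^sub>R v) - B y \<le> c * t)"
  (is "?lhs \<longleftrightarrow> ?rhs")
proof
  assume L: ?lhs
  show ?rhs
  proof (intro allI impI)
    fix c assume "c > s"
    then have "\<forall>\<^sub>F z in nhds x \<times>\<^sub>F at_right 0. (\<lambda>(y, t). ereal ((B (y + t *\<^sub>R v) - B y) / t)) z < ereal c"
      using L unfolding clarke_dirderiv_def Limsup_le_iff by simp
    then obtain d where "d > 0"
      "\<forall>y t. dist y x < d \<and> 0 < t \<and> t < d \<longrightarrow> (B (y + t *\<^sub>R v) - B y) / t < c"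
      unfolding eventually_nhds_times_at_right_0 by auto
    then show "\<exists>d>0. \<forall>y t. dist y x < d \<and> 0 < t \<and> t < d \<longrightarrow> B (y + t *\<^sub>R v) - B y \<le> c * t"
      by (intro exI[of _ d]) (auto simp: pos_divide_less_eq less_imp_le)
  qed
next
  assume R: ?rhs
  show ?lhs
    unfolding clarke_dirderiv_def Limsup_le_iff
  proof (intro allI impI)
    fix c' assume "ereal s < c'"
    then obtain c where c: "s < c" "ereal c < c'"
      using ereal_dense2[OF \<open>ereal s < c'\<close>] by auto
    obtain d where "d > 0" and d: "\<And>y t. dist y x < d \<Longrightarrow> 0 < t \<Longrightarrow> t < d \<Longrightarrow> B (y + t *\<^sub>R v) - B y \<le> c * t"
      using R c(1) by blast
    have "ereal ((B (y + t *\<^sub>R v) - B y) / t) < c'" if "dist y x < d" "0 < t" "t < d" for y t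
    proof -
      have "(B (y + t *\<^sub>R v) - B y) / t \<le> c" using d[OF that] that by (simp add: pos_divide_le_eq)
      then show ?thesis using c(2) by (metis ereal_less_eq(3) le_less_trans)
    qed
    then show "\<forall>\<^sub>F z in nhds x \<times>\<^sub>F at_right 0. (\<lambda>(y, t). ereal ((B (y + t *\<^sub>R v) - B y) / t)) z < c'"
      unfolding eventually_nhds_times_at_right_0 using \<open>d > 0\<close> by auto
  qed
qed

lemma clarke_dirderiv_scaleR_le:
  assumes v: "clarke_dirderiv B x v \<le> ereal s" and k: "0 \<le> k"
  shows "clarke_dirderiv B x (k *\<^sub>R v) \<le> ereal (k * s)"
proof (cases "k = 0")
  case True
  then show ?thesis by (auto simp: clarke_dirderiv_le_iff intro!: exI[of _ 1])
next
  case False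
  then have k: "k > 0" using k by simp
  show ?thesis
    unfolding clarke_dirderiv_le_iff
  proof (intro allI impI)
    fix c assume "k * s < c"
    then have "s < c / k" using k by (simp add: field_simps)
    then obtain d where "d > 0" and
      d: "\<And>y t. dist y x < d \<Longrightarrow> 0 < t \<Longrightarrow> t < d \<Longrightarrow> B (y + t *\<^sub>R v) - B y \<le> c / k * t"
      using v unfolding clarke_dirderiv_le_iff by blast
    have "B (y + t *\<^sub>R k *\<^sub>R v) - B y \<le> c * t"
      if "dist y x < min d (d / k)" "0 < t" "t < min d (d / k)" for y t
      using d[of y "t * k"] that k by (simp add: field_simps)
    then show "\<exists>d>0. \<forall>y t. dist y x < d \<and> 0 < t \<and> t < d \<longrightarrow> B (y + t *\<^sub>R k *\<^sub>R v) - B y \<le> c * t"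
      using \<open>d > 0\<close> k by (intro exI[of _ "min d (d / k)"]) auto
  qed
qed

text \<open>A step along \<open>v + w\<close> from \<open>y\<close> is a step along \<open>v\<close> followed by a step along \<open>w\<close> from the moved
  base point \<open>y + t v\<close>. The limsup runs over all base points near \<open>x\<close>, so it controls both steps;
  an ordinary directional derivative at \<open>x\<close> would not be subadditive.\<close>
lemma clarke_dirderiv_add_le:
  assumes v: "clarke_dirderiv B x v \<le> ereal s" and w: "clarke_dirderiv B x w \<le> ereal r"
  shows "clarke_dirderiv B x (v + w) \<le> ereal (s + r)"
  unfolding clarke_dirderiv_le_iff
proof (intro allI impI)
  fix c assume "s + r < c"
  define e where "e = (c - s - r) / 2"
  have e: "s < s + e" "r < r + e" "s + e + (r + e) = c" using \<open>s + r < c\<close> by (simp_all add: e_def field_simps)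
  obtain d1 where "d1 > 0" and
    d1: "\<And>y t. dist y x < d1 \<Longrightarrow> 0 < t \<Longrightarrow> t < d1 \<Longrightarrow> B (y + t *\<^sub>R v) - B y \<le> (s + e) * t"
    using v[unfolded clarke_dirderiv_le_iff, rule_format, OF e(1)] by blast
  obtain d2 where "d2 > 0" and
    d2: "\<And>y t. dist y x < d2 \<Longrightarrow> 0 < t \<Longrightarrow> t < d2 \<Longrightarrow> B (y + t *\<^sub>R w) - B y \<le> (r + e) * t"
    using w[unfolded clarke_dirderiv_le_iff, rule_format, OF e(2)] by blast
  (* The factor 2 + norm v keeps the moved base point y + t v within d2 of x. *)
  define d where "d = min d1 (d2 / (2 + norm v))"
  have n: "2 + norm v > 0" using norm_ge_zero[of v] by linarith
  have "d > 0" "d \<le> d1" using \<open>d1 > 0\<close> \<open>d2 > 0\<close> n by (simp_all add: d_def)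
  have "d * (2 + norm v) \<le> d2 / (2 + norm v) * (2 + norm v)"
    using n by (intro mult_right_mono) (auto simp: d_def)
  then have d_d2: "d * (2 + norm v) \<le> d2" using n by simp
  have "B (y + t *\<^sub>R (v + w)) - B y \<le> c * t" if yt: "dist y x < d" "0 < t" "t < d" for y t
  proof -
    have "dist (y + t *\<^sub>R v) x \<le> dist y x + t * norm v"
      using yt(2) norm_triangle_ineq[of "y - x" "t *\<^sub>R v"] by (simp add: dist_norm algebra_simps)
    also have "\<dots> < d + d * norm v"
      using yt by (intro add_less_le_mono mult_right_mono) auto
    also have "\<dots> \<le> d2" using d_d2 \<open>d > 0\<close> by (simp add: algebra_simps)
    finally have "dist (y + t *\<^sub>R v) x < d2" .
    moreover have "0 \<le> d * norm v" using \<open>d > 0\<close> by simp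
    then have "d \<le> d2" using d_d2[unfolded distrib_left] \<open>d > 0\<close> by linarith
    ultimately have "B (y + t *\<^sub>R v + t *\<^sub>R w) - B (y + t *\<^sub>R v) \<le> (r + e) * t"
      using d2 yt by simp
    moreover have "B (y + t *\<^sub>R v) - B y \<le> (s + e) * t"
      using d1 yt \<open>d \<le> d1\<close> by simp
    ultimately have "B (y + t *\<^sub>R v + t *\<^sub>R w) - B y \<le> (s + e + (r + e)) * t"
      by (simp add: algebra_simps)
    then show ?thesis using e(3) by (simp add: scaleR_add_right add.assoc)
  qed
  with \<open>d > 0\<close> show "\<exists>d>0. \<forall>y t. dist y x < d \<and> 0 < t \<and> t < d \<longrightarrow> B (y + t *\<^sub>R (v + w)) - B y \<le> c * t"
    by blast
qed

lemma clarke_dirderiv_lipschitz_bound: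
  assumes "r > 0" and B: "M-lipschitz_on (cball x r) B"
  shows "clarke_dirderiv B x v \<le> ereal (M * norm v)"
  unfolding clarke_dirderiv_le_iff
proof (intro allI impI)
  fix c assume c: "M * norm v < c"
  define d where "d = r / (2 + norm v)"
  have n: "2 + norm v > 0" using norm_ge_zero[of v] by linarith
  have "d > 0" "d * (2 + norm v) = r" using \<open>r > 0\<close> n by (simp_all add: d_def)
  then have d: "d * 2 + d * norm v = r" by (simp add: distrib_left)
  have "B (y + t *\<^sub>R v) - B y \<le> c * t" if yt: "dist y x < d" "0 < t" "t < d" for y t
  proof -
    have "dist (y + t *\<^sub>R v) x \<le> dist y x + t * norm v"
      using yt(2) norm_triangle_ineq[of "y - x" "t *\<^sub>R v"]
      by (simp add: dist_norm algebra_simps)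
    moreover have "t * norm v \<le> d * norm v" using yt by (intro mult_right_mono) auto
    moreover have "0 \<le> d * norm v" using \<open>d > 0\<close> by simp
    ultimately have "dist (y + t *\<^sub>R v) x \<le> r" "dist y x \<le> r"
      using d yt by linarith+
    then have "y + t *\<^sub>R v \<in> cball x r" "y \<in> cball x r"
      by (simp_all add: dist_commute[of x])
    then have "dist (B (y + t *\<^sub>R v)) (B y) \<le> M * dist (y + t *\<^sub>R v) y"
      by (rule lipschitz_onD[OF B])
    then have "B (y + t *\<^sub>R v) - B y \<le> M * norm v * t"
      using yt by (simp add: dist_norm algebra_simps)
    also have "\<dots> \<le> c * t" using c yt by (intro mult_right_mono) auto
    finally show ?thesis .
  qed
  with \<open>d > 0\<close> show "\<exists>d>0. \<forall>y t. dist y x < d \<and> 0 < t \<and> t < d \<longrightarrow> B (y + t *\<^sub>R v) - B y \<le> c * t"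
    by blast
qed

text \<open>The finite-dimensional Hahn-Banach theorem for a sublinear function that is given by its
  epigraph \<open>E\<close>: a hyperplane that separates the cone \<open>E\<close> from a point below it is the graph of a
  linear function under \<open>E\<close>. It is not vertical because \<open>E\<close> lies over all of the space.\<close>
lemma sublinear_epigraph_support:
  fixes E :: "('a::euclidean_space \<times> real) set"
  assumes cone: "convex_cone E"
    and up: "\<And>v s s'. (v, s) \<in> E \<Longrightarrow> s \<le> s' \<Longrightarrow> (v, s') \<in> E"
    and total: "\<And>v. \<exists>s. (v, s) \<in> E"
    and below: "(w, c) \<notin> E"
  obtains \<zeta> where "\<And>v s. (v, s) \<in> E \<Longrightarrow> \<zeta> \<bullet> v \<le> s" and "c \<le> \<zeta> \<bullet> w"
proof -
  have zero: "(0, 0) \<in> E" using convex_cone_contains_0[OF cone] by (simp add: zero_prod_def)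
  have "convex E" "E \<noteq> {}" "E \<inter> {(w, c)} = {}" using cone below zero by (auto simp: convex_cone_def)
  then obtain a b where ab: "a \<noteq> 0" and E_le: "\<And>z. z \<in> E \<Longrightarrow> a \<bullet> z \<le> b" and ge: "b \<le> a \<bullet> (w, c)"
    using separating_hyperplane_sets[of E "{(w, c)}"] by blast
  obtain \<alpha> \<beta> where a: "a = (\<alpha>, \<beta>)" by force
  have "b \<ge> 0" using E_le[OF zero] by (simp add: a)
  (* The bound b can be lowered to 0 since a positive value on the cone could be scaled beyond b. *)
  have neg: "\<alpha> \<bullet> v + \<beta> * s \<le> 0" if "(v, s) \<in> E" for v s
  proof (rule ccontr)
    assume *: "\<not> ?thesis"
    let ?q = "\<alpha> \<bullet> v + \<beta> * s"
    have k: "0 \<le> (b + 1) / ?q" using * \<open>b \<ge> 0\<close> by (intro divide_nonneg_nonneg) auto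
    have "a \<bullet> (((b + 1) / ?q) *\<^sub>R (v, s)) = (b + 1) / ?q * ?q"
      unfolding inner_scaleR_right by (simp add: a)
    also have "\<dots> = b + 1" using * by simp
    finally show False
      using E_le[OF convex_cone_scaleR[OF cone k that]] by linarith
  qed
  have "(0, 1) \<in> E" using up[OF zero] by simp
  then have "\<beta> \<le> 0" using neg by fastforce
  moreover have "\<beta> \<noteq> 0"
  proof
    assume "\<beta> = 0"
    then have "\<alpha> \<bullet> \<alpha> \<le> 0" using total[of \<alpha>] neg by fastforce
    then have "\<alpha> = 0" by (metis inner_eq_zero_iff inner_ge_zero order.antisym)
    then show False using ab a \<open>\<beta> = 0\<close> by (simp add: zero_prod_def)
  qed
  ultimately have "\<beta> < 0" by simp
  show ?thesis
  proof (rule that[of "(1 / - \<beta>) *\<^sub>R \<alpha>"])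
    fix v s assume "(v, s) \<in> E"
    then show "((1 / - \<beta>) *\<^sub>R \<alpha>) \<bullet> v \<le> s"
      using neg[of v s] \<open>\<beta> < 0\<close> by (auto simp: field_simps)
  next
    have "0 \<le> \<alpha> \<bullet> w + \<beta> * c" using ge \<open>b \<ge> 0\<close> by (simp add: a)
    then show "c \<le> ((1 / - \<beta>) *\<^sub>R \<alpha>) \<bullet> w"
      using \<open>\<beta> < 0\<close> by (auto simp: field_simps)
  qed
qed

text \<open>Were the derivative along \<open>w\<close> greater than some \<open>c > 0\<close>, the point \<open>(w, c)\<close> would lie below the
  epigraph of the directional derivative, and a supporting linear function would be a generalized
  gradient with inner product at least \<open>c\<close> with \<open>w\<close>. The Lipschitz condition makes the directional
  derivative finite in every direction.\<close>
lemma clarke_dirderiv_nonpos: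
  fixes B :: "'a::euclidean_space \<Rightarrow> real"
  assumes "r > 0" and B: "M-lipschitz_on (cball x r) B"
    and grad: "\<And>\<zeta>. \<zeta> \<in> clarke_gradient B x \<Longrightarrow> \<zeta> \<bullet> w \<le> 0"
  shows "clarke_dirderiv B x w \<le> 0"
proof (rule ccontr)
  assume "\<not> clarke_dirderiv B x w \<le> 0"
  then obtain c where c: "0 < c" "ereal c < clarke_dirderiv B x w"
    using ereal_dense2[of 0 "clarke_dirderiv B x w"] by (auto simp: not_le)
  let ?E = "{(v, s). clarke_dirderiv B x v \<le> ereal s}"
  have cone: "convex_cone ?E"
    unfolding convex_cone_iff
    using clarke_dirderiv_scaleR_le[of B x] clarke_dirderiv_add_le[of B x]
      clarke_dirderiv_scaleR_le[OF clarke_dirderiv_lipschitz_bound[OF assms(1,2)], of 0]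
    by (auto simp: zero_prod_def)
  have total: "\<exists>s. (v, s) \<in> ?E" for v
    using clarke_dirderiv_lipschitz_bound[OF assms(1,2)] by auto
  obtain \<zeta> where \<zeta>: "\<And>v s. (v, s) \<in> ?E \<Longrightarrow> \<zeta> \<bullet> v \<le> s" "c \<le> \<zeta> \<bullet> w"
  proof (rule sublinear_epigraph_support[OF cone _ total])
    show "(v, s') \<in> ?E" if "(v, s) \<in> ?E" "s \<le> s'" for v s s'
      using that by (auto intro: order_trans)
    show "(w, c) \<notin> ?E" using c by auto
  qed blast
  have "\<zeta> \<in> clarke_gradient B x"
    unfolding clarke_gradient_def
  proof (intro CollectI allI, rule ccontr)
    fix v assume "\<not> ereal (\<zeta> \<bullet> v) \<le> clarke_dirderiv B x v"
    then obtain s where s: "clarke_dirderiv B x v < ereal s" "s < \<zeta> \<bullet> v"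
      using ereal_dense2[of "clarke_dirderiv B x v" "ereal (\<zeta> \<bullet> v)"] by (auto simp: not_le)
    then have "\<zeta> \<bullet> v \<le> s" by (intro \<zeta>(1)) auto
    with s show False by simp
  qed
  then show False using grad \<zeta>(2) c(1) by fastforce
qed

text \<open>The curve is replaced by its tangent line at a cost that the Lipschitz constant controls. To the
  right of \<open>t\<close> the tangent step starts from \<open>x t\<close>; to the left it starts from the earlier point
  \<open>x s\<close>, which the limsup over nearby base points also covers.\<close>
lemma clarke_nonpos_imp_slope:
  fixes x :: "real \<Rightarrow> 'a::real_normed_vector"
  assumes x: "(x has_vector_derivative w) (at t)"
    and "r > 0" and B: "M-lipschitz_on (cball (x t) r) B"
    and w: "clarke_dirderiv B (x t) w \<le> 0"
    and "e > 0"
  shows "\<exists>d>0. \<forall>u v. u \<le> t \<and> t \<le> v \<and> t - u < d \<and> v - t < d \<longrightarrow> B (x v) - B (x u) \<le> e * (v - u)"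
proof -
  have M: "M \<ge> 0" using B by (rule lipschitz_on_nonneg)
  (* The tangent error h per unit of time costs at most M h, which is at most e / 2; the other
     half of e is the slack in the directional derivative. *)
  define h where "h = e / (4 * (M + 1))"
  have h: "h > 0" "2 * (M * h) \<le> e / 2" using \<open>e > 0\<close> M by (simp_all add: h_def field_simps)
  obtain d1 where "d1 > 0" and d1: "\<And>s. \<bar>s - t\<bar> < d1 \<Longrightarrow> norm (x s - x t - (s - t) *\<^sub>R w) \<le> h * \<bar>s - t\<bar>"
    using x h(1) unfolding has_vector_derivative_def has_derivative_at_alt real_norm_def by blast
  have "e / 2 > 0" using \<open>e > 0\<close> by simp
  then obtain d2 where "d2 > 0" and
    d2: "\<And>y s. dist y (x t) < d2 \<Longrightarrow> 0 < s \<Longrightarrow> s < d2 \<Longrightarrow> B (y + s *\<^sub>R w) - B y \<le> e / 2 * s"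
    using w[unfolded zero_ereal_def clarke_dirderiv_le_iff, rule_format, OF \<open>e / 2 > 0\<close>] by blast
  (* k bounds the speed of the curve near t, and m * k how far it moves within time m. *)
  define k where "k = h + norm w + 1"
  have k: "k \<ge> 1" "k \<ge> 0" using h by (simp_all add: k_def)
  define m where "m = min d2 r / (3 * k)"
  have "m > 0" using \<open>d2 > 0\<close> \<open>r > 0\<close> k by (simp add: m_def)
  have m: "3 * (m * k) = min d2 r" using k by (simp add: m_def)
  have mk: "m * k > 0" "m \<le> m * k" using \<open>m > 0\<close> k by (simp_all)
  have small: "m < d2" "m * k < d2" using m mk min.cobounded1[of d2 r] by linarith+
  define d where "d = min d1 m"
  have "d > 0" using \<open>d1 > 0\<close> \<open>m > 0\<close> by (simp add: d_def)
  have close: "norm (x s - x t) \<le> m * k" "norm (x s - x t - (s - t) *\<^sub>R w) \<le> h * \<bar>s - t\<bar>"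
    "norm ((s - t) *\<^sub>R w) \<le> m * k"
    if "\<bar>s - t\<bar> < d" for s
  proof -
    show 1: "norm (x s - x t - (s - t) *\<^sub>R w) \<le> h * \<bar>s - t\<bar>" using d1 that by (simp add: d_def)
    have "norm (x s - x t) \<le> norm (x s - x t - (s - t) *\<^sub>R w) + norm ((s - t) *\<^sub>R w)"
      by (metis norm_triangle_sub add.commute)
    also have "\<dots> \<le> h * \<bar>s - t\<bar> + \<bar>s - t\<bar> * norm w" using 1 by simp
    also have "\<dots> \<le> \<bar>s - t\<bar> * k" by (simp add: k_def algebra_simps)
    also have "\<dots> \<le> m * k" using that k by (intro mult_right_mono) (auto simp: d_def)
    finally show "norm (x s - x t) \<le> m * k" .
    have "\<bar>s - t\<bar> * norm w \<le> m * k"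
      using that h by (intro mult_mono) (auto simp: d_def k_def)
    then show "norm ((s - t) *\<^sub>R w) \<le> m * k" by simp
  qed
  have right: "B (x s) - B (x t) \<le> e * (s - t)" if s: "t \<le> s" "s - t < d" for s
  proof (cases "s = t")
    case False
    let ?y = "x t + (s - t) *\<^sub>R w"
    note c = close[of s]
    have "\<bar>s - t\<bar> < d" using s by simp
    have "x s \<in> cball (x t) r" "?y \<in> cball (x t) r"
      using c[OF \<open>\<bar>s - t\<bar> < d\<close>] m mk by (simp_all add: dist_norm norm_minus_commute)
    then have "dist (B (x s)) (B ?y) \<le> M * dist (x s) ?y" by (rule lipschitz_onD[OF B])
    also have "\<dots> \<le> M * (h * (s - t))"
      using c(2)[OF \<open>\<bar>s - t\<bar> < d\<close>] s M by (intro mult_left_mono) (auto simp: dist_norm algebra_simps)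
    finally have "B (x s) - B ?y \<le> M * h * (s - t)" by (simp add: dist_real_def)
    moreover have "s - t < d2" using s small by (simp add: d_def)
    then have "B ?y - B (x t) \<le> e / 2 * (s - t)" using s False \<open>d2 > 0\<close> by (intro d2) auto
    ultimately have "B (x s) - B (x t) \<le> (M * h + e / 2) * (s - t)"
      unfolding distrib_right by linarith
    also have "\<dots> \<le> e * (s - t)" 
      using s h M \<open>e > 0\<close> mult_nonneg_nonneg[OF M less_imp_le[OF h(1)]] by (intro mult_right_mono) auto
    finally show ?thesis .
  qed simp
  have left: "B (x t) - B (x s) \<le> e * (t - s)" if s: "s \<le> t" "t - s < d" for s
  proof (cases "s = t")
    case False
    let ?y = "x s + (t - s) *\<^sub>R w"
    note c = close[of s]
    have "\<bar>s - t\<bar> < d" using s by simp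
    note c = c[OF this]
    have "norm (?y - x t) \<le> norm (x s - x t) + norm ((s - t) *\<^sub>R w)"
      by (metis (no_types, opaque_lifting) add_diff_eq diff_add_eq minus_diff_eq norm_minus_cancel norm_triangle_ineq scaleR_minus_left)
    then have "?y \<in> cball (x t) r" "x t \<in> cball (x t) r"
      using c m mk \<open>r > 0\<close> by (simp_all add: dist_norm norm_minus_commute)
    then have "dist (B ?y) (B (x t)) \<le> M * dist ?y (x t)" by (rule lipschitz_onD[OF B])
    also have "\<dots> \<le> M * (h * (t - s))"
      using c(2) s M by (intro mult_left_mono) (auto simp: dist_norm algebra_simps)
    finally have "B (x t) - B ?y \<le> M * h * (t - s)" by (simp add: dist_real_def)
    moreover have "t - s < d2" "dist (x s) (x t) < d2" using s small c by (simp_all add: d_def dist_norm)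
    then have "B ?y - B (x s) \<le> e / 2 * (t - s)" using s False by (intro d2) auto
    ultimately have "B (x t) - B (x s) \<le> (M * h + e / 2) * (t - s)"
      unfolding distrib_right by linarith
    also have "\<dots> \<le> e * (t - s)" 
      using s h M \<open>e > 0\<close> mult_nonneg_nonneg[OF M less_imp_le[OF h(1)]] by (intro mult_right_mono) auto
    finally show ?thesis .
  qed simp
  have "B (x v) - B (x u) \<le> e * (v - u)" if "u \<le> t" "t \<le> v" "t - u < d" "v - t < d" for u v
    using left[of u] right[of v] that by (simp add: algebra_simps)
  with \<open>d > 0\<close> show ?thesis by blast
qed

section \<open>Invariance of the barrier set\<close>

lemma barrier_rate_nonpos_imp_clarke_dirderiv_nonpos:
  fixes B :: "'a::euclidean_space \<Rightarrow> real"
  assumes B: "locally_lipschitz B" and rate: "barrier_rate B F (x, u) \<le> 0" and w: "w \<in> F (x, u)"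
  shows "clarke_dirderiv B x w \<le> 0"
proof -
  obtain r M where "r > 0" "M-lipschitz_on (cball x r) B"
    using B unfolding locally_lipschitz_def by blast
  then show ?thesis
  proof (rule clarke_dirderiv_nonpos)
    fix \<zeta> assume "\<zeta> \<in> clarke_gradient B x"
    then have "ereal (\<zeta> \<bullet> w) \<le> barrier_rate B F (x, u)"
      unfolding barrier_rate_def using w by (auto intro!: SUP_upper2[of "(\<zeta>, w)"])
    then have "ereal (\<zeta> \<bullet> w) \<le> 0" using rate by (rule order_trans)
    then show "\<zeta> \<bullet> w \<le> 0" by simp
  qed
qed

lemma locally_lipschitz_imp_continuous_on:
  assumes "locally_lipschitz f"
  shows "continuous_on S f"
proof -
  have "isCont f x" for x
  proof -
    obtain r M where "r > 0" "M-lipschitz_on (cball x r) f"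
      using assms unfolding locally_lipschitz_def by blast
    then have "continuous_on (ball x r) f"
      using lipschitz_on_continuous_on continuous_on_subset ball_subset_cball by blast
    then show ?thesis using \<open>r > 0\<close> by (simp add: continuous_on_eq_continuous_at)
  qed
  then show ?thesis by (simp add: continuous_at_imp_continuous_on)
qed

text \<open>A solution that left \<open>{B \<le> 0}\<close> would have a last time \<open>t0\<close> in it. At that time the solution is
  in the barrier set, so shortly afterwards it is in \<open>UK\<close> outside the barrier set, where \<open>B\<close> cannot
  grow; yet \<open>B\<close> becomes positive. Working near \<open>x t0\<close> only, a single Lipschitz constant of \<open>B\<close>
  serves to make \<open>B \<circ> x\<close> absolutely continuous.\<close>
lemma barrier_invariance:
  fixes B :: "'a::real_normed_vector \<Rightarrow> real"
  assumes sol: "inclusion_solution G Cx D x" and init: "x 0 \<in> barrier_set B Cx"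
    and B: "locally_lipschitz B" and UK: "open UK" "barrier_set B Cx \<subseteq> UK"
    and decrease: "\<And>y v. y \<in> (UK - barrier_set B Cx) \<inter> Cx \<Longrightarrow> v \<in> G y \<Longrightarrow> clarke_dirderiv B y v \<le> 0"
    and "t1 \<in> D"
  shows "B (x t1) \<le> 0"
proof (rule ccontr)
  assume "\<not> B (x t1) \<le> 0"
  then have t1: "B (x t1) > 0" by simp
  have D: "is_interval D" "0 \<in> D" "D \<subseteq> {0..}" and ac: "locally_absolutely_continuous_on D x"
    and stay: "\<And>t. t \<in> interior D \<Longrightarrow> x t \<in> Cx"
    and ae: "AE t in lebesgue. t \<in> D \<longrightarrow> (\<exists>v\<in>G (x t). (x has_vector_derivative v) (at t within D))"
    using sol unfolding inclusion_solution_def by auto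
  have "0 \<le> t1" using D \<open>t1 \<in> D\<close> by auto
  have sub: "{0..t1} \<subseteq> D" using mem_is_interval_1_I[OF D(1,2) \<open>t1 \<in> D\<close>] by auto
  have inner: "t \<in> interior D" if "0 < t" "t < t1" for t
    by (rule interiorI[of "{0<..<t1}"]) (use that sub in auto)
  have ac_seg: "absolutely_continuous_on_interval s t x" if "0 \<le> s" "s \<le> t" "t \<le> t1" for s t
  proof -
    have "{s..t} \<subseteq> D" using sub that by auto
    then show ?thesis using ac that unfolding locally_absolutely_continuous_on_def by blast
  qed
  have cont: "continuous_on {0..t1} x"
    using ac_seg \<open>0 \<le> t1\<close> by (intro absolutely_continuous_imp_continuous_on) auto
  have contB: "continuous_on {0..t1} (\<lambda>t. B (x t))"
    using continuous_on_compose2[OF locally_lipschitz_imp_continuous_on[OF B, of UNIV] cont] by simp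
  let ?Z = "{t \<in> {0..t1}. B (x t) \<le> 0}"
  have "closed ?Z"
    using continuous_closed_preimage[OF contB _ closed_atMost[of 0]]
    by (simp add: vimage_def Int_def)
  moreover have "bounded ?Z" by (rule bounded_subset[of "{0..t1}"]) auto
  ultimately have "compact ?Z" by (simp add: compact_eq_bounded_closed)
  moreover have "0 \<in> ?Z" using init \<open>0 \<le> t1\<close> by (simp add: barrier_set_def)
  ultimately obtain t0 where t0: "t0 \<in> ?Z" and last: "\<And>t. t \<in> ?Z \<Longrightarrow> t \<le> t0"
    using compact_attains_sup[of ?Z] by blast
  have "0 \<le> t0" "t0 < t1" using t0 t1 by (auto simp: less_le)
  have pos: "B (x t) > 0" if "t0 < t" "t \<le> t1" for t
    using last[of t] that \<open>0 \<le> t0\<close> by force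
  (* Solutions satisfy the constraint at interior times only, so time 0 relies on the start in K. *)
  have "x t0 \<in> Cx"
    using init inner[of t0] stay \<open>0 \<le> t0\<close> \<open>t0 < t1\<close> by (cases "t0 = 0") (auto simp: barrier_set_def)
  then have "x t0 \<in> UK" using t0 UK(2) by (auto simp: barrier_set_def)
  then obtain r1 where r1: "r1 > 0" "ball (x t0) r1 \<subseteq> UK" using UK(1) open_contains_ball by blast
  obtain r2 M where r2: "r2 > 0" "M-lipschitz_on (cball (x t0) r2) B"
    using B unfolding locally_lipschitz_def by blast
  have "min r1 r2 > 0" using r1 r2 by simp
  then obtain d where "d > 0" and d: "\<And>t. t \<in> {0..t1} \<Longrightarrow> dist t t0 < d \<Longrightarrow> dist (x t) (x t0) < min r1 r2"
    using cont t0 unfolding continuous_on_iff by blast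
  define b where "b = min t1 (t0 + d / 2)"
  have b: "t0 < b" "b \<le> t1" using \<open>d > 0\<close> \<open>t0 < t1\<close> by (auto simp: b_def)
  have near: "dist (x t) (x t0) < min r1 r2" if "t \<in> {t0..b}" for t
    using that \<open>0 \<le> t0\<close> \<open>d > 0\<close> b by (intro d) (auto simp: b_def dist_real_def)
  obtain N where "{t \<in> space lebesgue. \<not> (t \<in> D \<longrightarrow>
        (\<exists>v\<in>G (x t). (x has_vector_derivative v) (at t within D)))} \<subseteq> N"
    and "emeasure lebesgue N = 0" "N \<in> sets lebesgue"
    by (rule AE_E[OF ae])
  then have N: "\<And>t. t \<in> D \<Longrightarrow> t \<notin> N \<Longrightarrow> \<exists>v\<in>G (x t). (x has_vector_derivative v) (at t within D)"
    "negligible N"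
    by (auto simp: negligible_iff_null_sets null_sets_def)
  (* The endpoints join the exceptional set: there x need not be differentiable from both sides,
     and at t0 the solution is still in K. *)
  have "B (x b) \<le> B (x t0)"
  proof (rule absolutely_continuous_nonincreasing[where f = "\<lambda>t. B (x t)" and N = "N \<union> {t0, b}"])
    show "t0 \<le> b" using b by simp
    show "absolutely_continuous_on_interval t0 b (\<lambda>t. B (x t))"
    proof (rule absolutely_continuous_lipschitz_compose[OF _ _ r2(2)])
      show "absolutely_continuous_on_interval t0 b x" using ac_seg \<open>0 \<le> t0\<close> b by simp
      show "x ` {t0..b} \<subseteq> cball (x t0) r2" using near by (fastforce simp: dist_commute)
    qed
    show "negligible (N \<union> {t0, b})" using N(2) by simp
  next
    fix t e :: real assume t: "t \<in> {t0..b} - (N \<union> {t0, b})" and "e > 0"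
    then have tt: "t0 < t" "t < b" by auto
    have int: "t \<in> interior D" using inner tt \<open>0 \<le> t0\<close> b by simp
    then have "t \<in> D" using interior_subset by blast
    then obtain v where v: "v \<in> G (x t)" "(x has_vector_derivative v) (at t within D)"
      using N(1)[of t] t by auto
    then have deriv: "(x has_vector_derivative v) (at t)" using at_within_interior[OF int] by simp
    have "x t \<in> ball (x t0) r1" using near[of t] tt by (simp add: dist_commute)
    then have "x t \<in> (UK - barrier_set B Cx) \<inter> Cx"
      using stay[OF int] pos[of t] tt b r1(2) by (auto simp: barrier_set_def)
    then have nonpos: "clarke_dirderiv B (x t) v \<le> 0" using decrease v(1) by blast
    obtain r M' where "r > 0" "M'-lipschitz_on (cball (x t) r) B"
      using B unfolding locally_lipschitz_def by blast
    from clarke_nonpos_imp_slope[OF deriv this nonpos \<open>e > 0\<close>]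
    show "\<exists>d>0. \<forall>u\<in>{t0..b}. \<forall>v\<in>{t0..b}. u \<le> t \<and> t \<le> v \<and> t - u < d \<and> v - t < d \<longrightarrow>
        B (x v) - B (x u) \<le> e * (v - u)" by blast
  qed
  then show False using pos[of b] b t0 by simp
qed

section \<open>Minimizers of strictly convex costs\<close>

lemma unique_strictly_convex_minimizer:
  fixes f :: "'a::euclidean_space \<Rightarrow> real"
  assumes S: "closed S" "convex S" "S \<noteq> {}" and f: "continuous_on UNIV f"
    and strict: "\<And>u v \<theta>. u \<noteq> v \<Longrightarrow> 0 < \<theta> \<Longrightarrow> \<theta> < 1 \<Longrightarrow>
      f (\<theta> *\<^sub>R u + (1 - \<theta>) *\<^sub>R v) < \<theta> * f u + (1 - \<theta>) * f v"
    and bdd: "(\<forall>\<alpha>. bounded {u. f u \<le> \<alpha>}) \<or> bounded S"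
  shows "\<exists>!u. is_arg_min f (\<lambda>u. u \<in> S) u"
proof (rule ex_ex1I)
  obtain u0 where u0: "u0 \<in> S" using S by blast
  let ?T = "S \<inter> {u. f u \<le> f u0}"
  have "bounded ?T" using bdd by (meson bounded_Int)
  moreover have "closed ?T"
    using S(1) f by (intro closed_Int closed_Collect_le continuous_on_const) auto
  ultimately have "compact ?T" by (simp add: compact_eq_bounded_closed)
  then obtain u where u: "u \<in> ?T" "\<And>v. v \<in> ?T \<Longrightarrow> f u \<le> f v"
    using continuous_attains_inf[of ?T f] u0 continuous_on_subset[OF f] by blast
  then have "f u \<le> f v" if "v \<in> S" for v
    using that by (cases "f v \<le> f u0") auto
  then show "\<exists>u. is_arg_min f (\<lambda>u. u \<in> S) u"
    using u(1) by (auto simp: is_arg_min_linorder)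
next
  fix u v assume "is_arg_min f (\<lambda>u. u \<in> S) u" "is_arg_min f (\<lambda>u. u \<in> S) v"
  then have u: "u \<in> S" "\<And>w. w \<in> S \<Longrightarrow> f u \<le> f w" and v: "v \<in> S" "\<And>w. w \<in> S \<Longrightarrow> f v \<le> f w"
    by (auto simp: is_arg_min_linorder)
  show "u = v"
  proof (rule ccontr)
    assume "u \<noteq> v"
    let ?m = "(1/2) *\<^sub>R u + (1 - 1/2) *\<^sub>R v"
    have "?m \<in> S" using S(2) u(1) v(1) by (intro convexD) auto
    then have "f u \<le> f ?m" "f v \<le> f ?m" using u v by auto
    moreover have "f ?m < 1/2 * f u + (1 - 1/2) * f v" using strict[OF \<open>u \<noteq> v\<close>, of "1/2"] by simp
    ultimately show False by simp
  qed
qed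

text \<open>Minimizers cannot escape to infinity: by convexity of the cost and of the values of \<open>U\<close>, far
  minimizers at points near \<open>x\<close> would yield equally good candidates on a fixed sphere around \<open>k x\<close>.
  The compactness of that sphere does what local boundedness of \<open>U\<close> does in Berge's theorem.\<close>
lemma continuous_on_unique_minimizer:
  fixes L :: "'a::metric_space \<times> 'b::euclidean_space \<Rightarrow> real"
  assumes L: "continuous_on UNIV L" and conv: "\<And>x. x \<in> A \<Longrightarrow> convex_on UNIV (\<lambda>u. L (x, u))"
    and U: "continuous_setmap A U" "\<And>x. x \<in> A \<Longrightarrow> convex (U x)"
    and k: "\<And>x. x \<in> A \<Longrightarrow> k x \<in> U x"
    and min: "\<And>x u. x \<in> A \<Longrightarrow> u \<in> U x \<Longrightarrow> L (x, k x) \<le> L (x, u)"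
    and unique: "\<And>x u. x \<in> A \<Longrightarrow> u \<in> U x \<Longrightarrow> L (x, u) \<le> L (x, k x) \<Longrightarrow> u = k x"
  shows "continuous_on A k"
proof (rule ccontr)
  assume "\<not> continuous_on A k"
  then obtain x e where x: "x \<in> A" and e: "e > 0"
    and far: "\<And>d. d > 0 \<Longrightarrow> \<exists>y\<in>A. dist y x < d \<and> e \<le> dist (k y) (k x)"
    unfolding continuous_on_iff by (meson not_le)
  have osc: "osc_setmap_at A U x" and lsc: "lsc_setmap_at A U x"
    using U(1) x by (auto simp: continuous_setmap_def)
  have step: "\<exists>y v w. y \<in> A \<and> dist y x < h \<and> dist v (k x) < h \<and> w \<in> U y \<and> w \<in> sphere (k x) e
      \<and> L (y, w) \<le> L (y, v)" if "h > 0" for h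
  proof -
    let ?V = "ball (k x) (min e h)"
    have "k x \<in> U x \<inter> ?V" using k[OF x] e \<open>h > 0\<close> by simp
    then have "open ?V \<and> U x \<inter> ?V \<noteq> {}" by blast
    then have "\<exists>N. open N \<and> x \<in> N \<and> (\<forall>z\<in>N \<inter> A. U z \<inter> ?V \<noteq> {})"
      by (rule lsc[unfolded lsc_setmap_at_def, rule_format])
    then obtain O' where O': "open O'" "x \<in> O'" "\<And>z. z \<in> O' \<Longrightarrow> z \<in> A \<Longrightarrow> U z \<inter> ?V \<noteq> {}"
      by (elim exE conjE) auto
    obtain d where "d > 0" "ball x d \<subseteq> O'" using O' open_contains_ball by blast
    then obtain y where y: "y \<in> A" "dist y x < min d h" "e \<le> dist (k y) (k x)"
      using far[of "min d h"] \<open>h > 0\<close> by auto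
    then have "y \<in> O'" using \<open>ball x d \<subseteq> O'\<close> by (auto simp: dist_commute)
    then obtain v where "v \<in> U y" "v \<in> ?V" using O'(3) y(1) by blast
    then have v: "v \<in> U y" "dist v (k x) < min e h" by (auto simp: dist_commute)
    (* The segment from v to the minimizer at y starts inside the sphere of radius e about k x and
       ends on or outside it. *)
    let ?p = "\<lambda>\<theta>. (1 - \<theta>) *\<^sub>R v + \<theta> *\<^sub>R k y"
    have "continuous_on {0..1} (\<lambda>\<theta>. dist (?p \<theta>) (k x))" by (intro continuous_intros)
    then obtain \<theta> where \<theta>: "0 \<le> \<theta>" "\<theta> \<le> 1" "dist (?p \<theta>) (k x) = e"
      using IVT'[of "\<lambda>\<theta>. dist (?p \<theta>) (k x)" 0 e 1] v y by auto
    have "?p \<theta> \<in> U y" using U(2)[OF y(1)] v(1) k[OF y(1)] \<theta> by (intro convexD) auto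
    moreover have "L (y, ?p \<theta>) \<le> (1 - \<theta>) * L (y, v) + \<theta> * L (y, k y)"
      using convex_onD[OF conv[OF y(1)] \<theta>(1,2), of v "k y"] by simp
    then have "L (y, ?p \<theta>) \<le> (1 - \<theta>) * L (y, v) + \<theta> * L (y, v)"
      using mult_left_mono[OF min[OF y(1) v(1)] \<theta>(1)] by linarith
    then have "L (y, ?p \<theta>) \<le> L (y, v)" by (simp add: algebra_simps)
    moreover have "?p \<theta> \<in> sphere (k x) e" using \<theta>(3) by (simp add: dist_commute)
    ultimately show ?thesis
      using y v by (intro exI[of _ y] exI[of _ v] exI[of _ "?p \<theta>"]) simp
  qed
  have "\<exists>y v w. y \<in> A \<and> dist y x < inverse (real (Suc n)) \<and> dist v (k x) < inverse (real (Suc n)) \<and>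
      w \<in> U y \<and> w \<in> sphere (k x) e \<and> L (y, w) \<le> L (y, v)" for n
    by (rule step) simp
  then obtain y v w where y: "\<And>n. y n \<in> A" "\<And>n. dist (y n) x < inverse (real (Suc n))"
    and v: "\<And>n. dist (v n) (k x) < inverse (real (Suc n))"
    and w: "\<And>n. w n \<in> U (y n)" "\<And>n. w n \<in> sphere (k x) e" "\<And>n. L (y n, w n) \<le> L (y n, v n)"
    by metis
  have y_lim: "y \<longlonglongrightarrow> x"
    using y(2) by (intro metric_tendsto_imp_tendsto[OF LIMSEQ_inverse_real_of_nat])
      (auto intro!: always_eventually less_imp_le simp del: of_nat_Suc)
  have v_lim: "v \<longlonglongrightarrow> k x"
    using v by (intro metric_tendsto_imp_tendsto[OF LIMSEQ_inverse_real_of_nat])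
      (auto intro!: always_eventually less_imp_le simp del: of_nat_Suc)
  obtain w0 r where w0: "w0 \<in> sphere (k x) e" "strict_mono r" "(w \<circ> r) \<longlonglongrightarrow> w0"
    using compact_sphere[of "k x" e] w(2) unfolding compact_def by metis
  have yr: "(y \<circ> r) \<longlonglongrightarrow> x" and vr: "(v \<circ> r) \<longlonglongrightarrow> k x"
    using y_lim v_lim w0(2) LIMSEQ_subseq_LIMSEQ by blast+
  have "w0 \<in> U x"
    using osc[unfolded osc_setmap_at_def, rule_format, of "y \<circ> r" "w \<circ> r" w0] y(1) w(1) yr w0(3) by simp
  moreover have "L (x, w0) \<le> L (x, k x)"
  proof (rule LIMSEQ_le)
    have lim: "(\<lambda>n. L ((y \<circ> r) n, z n)) \<longlonglongrightarrow> L (x, z0)" if "z \<longlonglongrightarrow> z0" for z z0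
      using continuous_on_tendsto_compose[OF L tendsto_Pair[OF yr that]] by simp
    show "(\<lambda>n. L ((y \<circ> r) n, (w \<circ> r) n)) \<longlonglongrightarrow> L (x, w0)" using lim w0(3) .
    show "(\<lambda>n. L ((y \<circ> r) n, (v \<circ> r) n)) \<longlonglongrightarrow> L (x, k x)" using lim vr .
    show "\<exists>N. \<forall>n\<ge>N. L ((y \<circ> r) n, (w \<circ> r) n) \<le> L ((y \<circ> r) n, (v \<circ> r) n)" using w(3) by simp
  qed
  ultimately have "w0 = k x" using unique x by blast
  then show False using w0(1) e by simp
qed

section \<open>The minimal-cost feedback\<close>

theorem theorem2:
  fixes Cx Xo Xu UK S1 :: "(real ^ 'n) set"
    and Cu :: "(real ^ 'm) set"
    and F :: "(real ^ 'n) \<times> (real ^ 'm) \<Rightarrow> (real ^ 'n) set"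
    and \<U> \<U>t :: "real ^ 'n \<Rightarrow> (real ^ 'm) set"
    and B :: "real ^ 'n \<Rightarrow> real"
    and L :: "(real ^ 'n) \<times> (real ^ 'm) \<Rightarrow> real"
  assumes U_map: "\<forall>x\<in>Cx. \<U> x \<subseteq> Cu"
    and A1: "closed (Cx \<times> Cu)"
    and A2: "usc_setmap (Cx \<times> Cu) F"
      "\<forall>z\<in>Cx \<times> Cu. F z \<noteq> {} \<and> compact (F z) \<and> convex (F z)"
    and A3: "lsc_setmap Cx \<U>" "\<forall>x\<in>Cx. \<U> x \<noteq> {} \<and> closed (\<U> x) \<and> convex (\<U> x)"
    and A4: "setmap_convex_in_snd Cx Cu F"
    and A5: "osc_setmap Cx \<U>"
    and sets: "Xo \<subseteq> Cx" "Xo \<inter> Xu = {}"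
    and cbf: "control_barrier_function F \<U> Cx Xo Xu B"
    and g_convex: "ereal_convex_in_snd Cx Cu (barrier_rate B F)"
    and D0_near_boundary:
      "\<exists>N. open N \<and> frontier (barrier_set B Cx) \<subseteq> N \<and>
         (\<forall>x\<in>N \<inter> Cx. strict_decrease_controls B F \<U> x \<noteq> {})"
    and UK: "open UK" "barrier_set B Cx \<subseteq> UK"
    and S1: "S1 = closure ((UK - barrier_set B Cx) \<inter> Cx)"
      "\<forall>x\<in>S1. strict_decrease_controls B F \<U> x \<noteq> {} \<and>
         (INF u\<in>\<U> x. barrier_rate B F (x, u)) \<le> 0"
    and Ut_map: "\<forall>x\<in>Cx. \<U>t x \<subseteq> Cu"
    and Ut_cont: "continuous_setmap Cx \<U>t"
    and Ut_values: "\<forall>x\<in>Cx. \<U>t x \<noteq> {} \<and> closed (\<U>t x) \<and> convex (\<U>t x)"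
    and Ut_decrease: "\<forall>x\<in>S1. \<U>t x \<subseteq> decrease_controls B F \<U> x"
    and Ut_sub: "\<forall>x\<in>Cx. \<U>t x \<subseteq> \<U> x"
    and L: "lower_semicontinuous L" "convex_on UNIV L" "strictly_convex_in_snd L"
    and bdd: "sublevel_bounded_in_snd L \<or> (\<forall>x\<in>Cx. bounded (\<U>t x))"
  shows "(\<forall>x\<in>Cx. \<exists>!u. is_arg_min (\<lambda>u. L (x, u)) (\<lambda>u. u \<in> \<U>t x) u) \<and>
    continuous_on (interior Cx) (min_selection L \<U>t) \<and>
    safe_inclusion (\<lambda>x. F (x, min_selection L \<U>t x)) Cx Xo Xu"
proof (intro conjI)
  let ?\<kappa> = "min_selection L \<U>t"
  have L_cont: "continuous_on UNIV L" using L(2) by (intro convex_on_continuous) auto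
  have L_cont_u: "continuous_on UNIV (\<lambda>u. L (x, u))" for x
    by (rule continuous_on_compose2[OF L_cont]) (auto intro!: continuous_intros)
  have L_conv_u: "convex_on UNIV (\<lambda>u. L (x, u))" for x
  proof (intro convex_onI convex_UNIV)
    fix t :: real and u v :: "real ^ 'm" assume "0 < t" "t < 1"
    moreover have "(1 - t) *\<^sub>R (x, u) + t *\<^sub>R (x, v) = (x, (1 - t) *\<^sub>R u + t *\<^sub>R v)"
      by (simp add: scaleR_left_diff_distrib)
    ultimately show "L (x, (1 - t) *\<^sub>R u + t *\<^sub>R v) \<le> (1 - t) * L (x, u) + t * L (x, v)"
      using convex_onD[OF L(2), of t "(x, u)" "(x, v)"] by simp
  qed
  show ex1: "\<forall>x\<in>Cx. \<exists>!u. is_arg_min (\<lambda>u. L (x, u)) (\<lambda>u. u \<in> \<U>t x) u"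
  proof
    fix x assume x: "x \<in> Cx"
    show "\<exists>!u. is_arg_min (\<lambda>u. L (x, u)) (\<lambda>u. u \<in> \<U>t x) u"
    proof (rule unique_strictly_convex_minimizer[OF _ _ _ L_cont_u])
      show "closed (\<U>t x)" "convex (\<U>t x)" "\<U>t x \<noteq> {}" using Ut_values x by blast+
      show "L (x, \<theta> *\<^sub>R u + (1 - \<theta>) *\<^sub>R v) < \<theta> * L (x, u) + (1 - \<theta>) * L (x, v)"
        if "u \<noteq> v" "0 < \<theta>" "\<theta> < 1" for u v \<theta>
        using L(3) that unfolding strictly_convex_in_snd_def by blast
      show "(\<forall>\<alpha>. bounded {u. L (x, u) \<le> \<alpha>}) \<or> bounded (\<U>t x)"
        using bdd x unfolding sublevel_bounded_in_snd_def by blast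
    qed
  qed
  have \<kappa>: "is_arg_min (\<lambda>u. L (x, u)) (\<lambda>u. u \<in> \<U>t x) (?\<kappa> x)" if "x \<in> Cx" for x
    unfolding min_selection_def arg_min_on_def arg_min_def using ex1 that by (metis someI_ex)
  then have \<kappa>_in: "?\<kappa> x \<in> \<U>t x" and \<kappa>_min: "\<And>u. u \<in> \<U>t x \<Longrightarrow> L (x, ?\<kappa> x) \<le> L (x, u)" if "x \<in> Cx" for x
    using that by (auto simp: is_arg_min_linorder)
  have "continuous_on Cx ?\<kappa>"
  proof (rule continuous_on_unique_minimizer[OF L_cont L_conv_u Ut_cont _ \<kappa>_in \<kappa>_min])
    fix x u assume "x \<in> Cx" "u \<in> \<U>t x" "L (x, u) \<le> L (x, ?\<kappa> x)"
    then have "is_arg_min (\<lambda>u. L (x, u)) (\<lambda>u. u \<in> \<U>t x) u"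
      unfolding is_arg_min_linorder using \<kappa>_min by (blast intro: order_trans)
    then show "u = ?\<kappa> x" using ex1 \<kappa> \<open>x \<in> Cx\<close> by blast
  qed (use Ut_values in auto)
  then show "continuous_on (interior Cx) ?\<kappa>"
    using continuous_on_subset interior_subset by blast
  show "safe_inclusion (\<lambda>x. F (x, ?\<kappa> x)) Cx Xo Xu"
    unfolding safe_inclusion_def
  proof (intro allI impI ballI)
    fix D x t
    assume sol: "inclusion_solution (\<lambda>x. F (x, ?\<kappa> x)) Cx D x \<and> x 0 \<in> Xo" and "t \<in> D"
    have B: "locally_lipschitz B" and B_sign: "\<forall>x\<in>Xu. 0 < B x" "\<forall>x\<in>Xo. B x \<le> 0"
      using cbf by (auto simp: control_barrier_function_def)
    have "B (x t) \<le> 0"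
    proof (rule barrier_invariance[OF _ _ B UK _ \<open>t \<in> D\<close>])
      show "inclusion_solution (\<lambda>x. F (x, ?\<kappa> x)) Cx D x" using sol by blast
      show "x 0 \<in> barrier_set B Cx" using sol B_sign(2) sets(1) by (auto simp: barrier_set_def)
    next
      fix y v assume y: "y \<in> (UK - barrier_set B Cx) \<inter> Cx" and v: "v \<in> F (y, ?\<kappa> y)"
      have "y \<in> S1" unfolding S1(1) by (rule subsetD[OF closure_subset y])
      then have "?\<kappa> y \<in> decrease_controls B F \<U> y" using Ut_decrease \<kappa>_in[of y] y by blast
      then have "barrier_rate B F (y, ?\<kappa> y) \<le> 0" by (simp add: decrease_controls_def)
      then show "clarke_dirderiv B y v \<le> 0"
        using B v by (intro barrier_rate_nonpos_imp_clarke_dirderiv_nonpos)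
    qed
    then show "x t \<in> - Xu" using B_sign(1) by force
  qed
qed

end
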